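(* Let $G=(V,E)$ be a primitive strongly regular graph with parameters $(v,k,\lambda,\mu)$, and let $k>\theta_1>\theta_2$ be the distinct eigenvalues of its $(0,1)$ adjacency matrix. Let $H$ be a subset of $V$ and let $S(G,H)$ be the graph obtained from $G$ by switching with respect to $H$. Suppose $v=2(k-\theta_1)$, and put $c=v/2-2\mu$. Then the following are equivalent: (i) $S(G,H)$ is a strongly regular graph with parameters $(v,k+c,\lambda+c,\mu+c)$; (ii) $|H|=v/2$ and the subgraph of $G$ induced by $H$ is $(k-\mu)$-regular.
   Context: A simple graph is strongly regular with parameters $(v,k,\lambda,\mu)$ if it has $v$ vertices, is $k$-regular, any two adjacent vertices have exactly $\lambda$ common neighbours, and any two distinct nonadjacent vertices have exactly $\mu$ common neighbours. It is primitive if both it and its complement are connected. The $(0,1)$ adjacency matrix has $(x,y)$ entry $1$ if $x,y$ are adjacent and $0$ otherwise. For $H\subseteq V$, the switched graph $S(G,H)$ has vertex set $V$; for $x,y$ both in $H$ or both in $V\setminus H$ adjacency is as in $G$, while for $x\in H$, $y\in V\setminus H$ the pair $x,y$ is adjacent in $S(G,H)$ if and only if it is not adjacent in $G$. *)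

theory Defs
  imports "Graph_Theory.Graph_Theory" "Jordan_Normal_Form.Char_Poly"
begin

(* Simple graphs are pair_graph's: finite, loopless, with a symmetric set of pairs as arcs, so that
   an edge {x, y} is the two arcs (x, y) and (y, x), and the out-degree is the valency. *)

(* Graph parameters are real, because switching shifts them by v/2 - 2 * mu, which is in general
   negative and is not assumed to be an integer. *)

definition regular :: "('a, 'b) pre_digraph \<Rightarrow> real \<Rightarrow> bool" where
  "regular G d \<longleftrightarrow> (\<forall>x \<in> verts G. real (out_degree G x) = d)"

definition common_neighbours :: "'a pair_pre_digraph \<Rightarrow> 'a \<Rightarrow> 'a \<Rightarrow> 'a set" where
  "common_neighbours G x y = {z \<in> pverts G. (x, z) \<in> parcs G \<and> (y, z) \<in> parcs G}"

definition strongly_regular ::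
    "'a pair_pre_digraph \<Rightarrow> real \<Rightarrow> real \<Rightarrow> real \<Rightarrow> real \<Rightarrow> bool" where
  "strongly_regular G v k lam mu \<longleftrightarrow>
     pair_graph G \<and> real (card (pverts G)) = v \<and> regular (with_proj G) k \<and>
     (\<forall>x \<in> pverts G. \<forall>y \<in> pverts G. (x, y) \<in> parcs G \<longrightarrow>
        real (card (common_neighbours G x y)) = lam) \<and>
     (\<forall>x \<in> pverts G. \<forall>y \<in> pverts G. x \<noteq> y \<longrightarrow> (x, y) \<notin> parcs G \<longrightarrow>
        real (card (common_neighbours G x y)) = mu)"

definition graph_complement :: "'a pair_pre_digraph \<Rightarrow> 'a pair_pre_digraph" where
  "graph_complement G =
     \<lparr>pverts = pverts G,
      parcs = {(x, y). x \<in> pverts G \<and> y \<in> pverts G \<and> x \<noteq> y \<and> (x, y) \<notin> parcs G}\<rparr>"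

definition primitive :: "'a pair_pre_digraph \<Rightarrow> bool" where
  "primitive G \<longleftrightarrow> Digraph_Component.connected (with_proj G) \<and>
     Digraph_Component.connected (with_proj (graph_complement G))"

definition switch :: "'a pair_pre_digraph \<Rightarrow> 'a set \<Rightarrow> 'a pair_pre_digraph" where
  "switch G H =
     \<lparr>pverts = pverts G,
      parcs = {(x, y). x \<in> pverts G \<and> y \<in> pverts G \<and>
                 (if x \<in> H \<longleftrightarrow> y \<in> H then (x, y) \<in> parcs G else (x, y) \<notin> parcs G)}\<rparr>"

(* Rows and columns follow the enumeration vs of the vertices; a different enumeration conjugates
   the matrix by a permutation and leaves its eigenvalues unchanged. *)
definition adjacency_matrix :: "'a list \<Rightarrow> 'a pair_pre_digraph \<Rightarrow> real mat" where
  "adjacency_matrix vs G =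
     mat (length vs) (length vs) (\<lambda>(i, j). if (vs ! i, vs ! j) \<in> parcs G then 1 else 0)"

end

theory Submission
  imports Defs
begin

text \<open>
  Let \<open>s\<close> be the \<open>\<plusminus>1\<close> indicator vector of \<open>H\<close>. Evaluating the quadratic equation of the
  adjacency matrix \<open>A\<close> at \<open>k\<close> and using \<open>v = 2 (k - \<theta>\<^sub>1)\<close> gives \<open>\<theta>\<^sub>2 = k - 2 \<mu>\<close> and
  \<open>c = \<theta>\<^sub>2 - \<theta>\<^sub>1 \<noteq> 0\<close>. If the switched graph is \<open>(k + c)\<close>-regular, then summing the entries of
  \<open>A s\<close> yields \<open>c (2|H| - v) = 0\<close>, hence (ii). Conversely, (ii) says that \<open>s\<close> is orthogonal to
  the constants and that \<open>g = A s - \<theta>\<^sub>2 s\<close> vanishes on \<open>H\<close>; as \<open>A g = \<theta>\<^sub>1 g\<close> and \<open>g\<close> sums to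
  zero, \<open>|g|\<^sup>2 = (\<theta>\<^sub>1 - \<theta>\<^sub>2) \<langle>g, s\<rangle> = 0\<close>. So \<open>A s = \<theta>\<^sub>2 s\<close>, and this determines all valencies and
  common neighbour counts of the switched graph.
\<close>

section \<open>The adjacency operator and the sign vector of a vertex set\<close>

definition adjacency :: "'a pair_pre_digraph \<Rightarrow> 'a \<Rightarrow> 'a \<Rightarrow> real" where
  "adjacency G x y = of_bool ((x, y) \<in> parcs G)"

text \<open>The adjacency matrix acting on functions on the vertices, so that no enumeration of the
  vertices is needed.\<close>

definition adj_op :: "'a pair_pre_digraph \<Rightarrow> ('a \<Rightarrow> real) \<Rightarrow> 'a \<Rightarrow> real" where
  "adj_op G f x = (\<Sum>y\<in>pverts G. adjacency G x y * f y)"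

definition sign_of :: "'a set \<Rightarrow> 'a \<Rightarrow> real" where
  "sign_of H x = (if x \<in> H then 1 else - 1)"

lemma sign_of_square [simp]: "sign_of H x * sign_of H x = 1"
  by (simp add: sign_of_def)

lemma adj_op_diff: "adj_op G (\<lambda>x. f x - g x) x = adj_op G f x - adj_op G g x"
  by (simp add: adj_op_def algebra_simps sum_subtractf)

lemma adj_op_scale: "adj_op G (\<lambda>x. t * f x) x = t * adj_op G f x"
  by (simp add: adj_op_def sum_distrib_left algebra_simps)

lemma sum_of_bool_card:
  assumes "finite A"
  shows "(\<Sum>x\<in>A. of_bool (P x)) = real (card {x \<in> A. P x})"
  using assms by (simp add: Int_def)

lemma sum_sign_of:
  assumes "finite V" "H \<subseteq> V"
  shows "(\<Sum>x\<in>V. sign_of H x) = 2 * real (card H) - real (card V)"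
proof -
  have "(\<Sum>x\<in>V. sign_of H x) = (\<Sum>x\<in>V. 2 * of_bool (x \<in> H) - 1)"
    by (rule sum.cong) (auto simp: sign_of_def)
  also have "\<dots> = 2 * real (card {x \<in> V. x \<in> H}) - real (card V)"
    by (simp add: sum_subtractf flip: sum_distrib_left sum_of_bool_card[OF assms(1)])
  also have "{x \<in> V. x \<in> H} = H"
    using assms by auto
  finally show ?thesis .
qed

section \<open>Valencies and common neighbour counts as sums\<close>

lemma out_degree_with_proj:
  assumes "pair_graph G"
  shows "real (out_degree (with_proj G) x) = (\<Sum>y\<in>pverts G. adjacency G x y)"
proof -
  interpret pair_graph G by fact
  have "out_arcs (with_proj G) x = Pair x ` {y \<in> pverts G. (x, y) \<in> parcs G}"
    by (auto simp: out_arcs_def image_iff dest: in_arcsD2)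
  hence "out_degree (with_proj G) x = card {y \<in> pverts G. (x, y) \<in> parcs G}"
    by (simp add: out_degree_def card_image inj_on_def)
  thus ?thesis
    unfolding adjacency_def by (simp only: sum_of_bool_card[OF pair_finite_verts])
qed

text \<open>The indicator of \<open>H\<close> is (1 + \<open>sign_of H y\<close>) / 2. Doubling the
  count clears the denominator and splits it into the full valency and the operator applied to the
  sign vector.\<close>

lemma out_degree_induced:
  assumes "pair_graph G" "H \<subseteq> pverts G" "x \<in> H"
  shows "2 * real (out_degree (with_proj G \<restriction> H) x)
           = (\<Sum>y\<in>pverts G. adjacency G x y) + adj_op G (sign_of H) x"
proof -
  interpret pair_graph G by fact
  have "out_arcs (with_proj G \<restriction> H) x = Pair x ` {y \<in> pverts G. y \<in> H \<and> (x, y) \<in> parcs G}"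
    using assms(2,3) by (auto simp: out_arcs_def image_iff)
  hence "out_degree (with_proj G \<restriction> H) x = card {y \<in> pverts G. y \<in> H \<and> (x, y) \<in> parcs G}"
    by (simp add: out_degree_def card_image inj_on_def)
  hence "2 * real (out_degree (with_proj G \<restriction> H) x)
      = 2 * (\<Sum>y\<in>pverts G. of_bool (y \<in> H \<and> (x, y) \<in> parcs G))"
    by (simp only: sum_of_bool_card[OF pair_finite_verts])
  also have "\<dots> = (\<Sum>y\<in>pverts G. adjacency G x y + adjacency G x y * sign_of H y)"
    unfolding sum_distrib_left
    by (rule sum.cong) (auto simp: adjacency_def sign_of_def)
  finally show ?thesis
    by (simp add: sum.distrib adj_op_def)
qed

lemma card_common_neighbours:
  assumes "pair_graph G"
  shows "real (card (common_neighbours G x y))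
           = (\<Sum>z\<in>pverts G. adjacency G x z * adjacency G y z)"
proof -
  interpret pair_graph G by fact
  have "(\<Sum>z\<in>pverts G. adjacency G x z * adjacency G y z)
      = (\<Sum>z\<in>pverts G. of_bool ((x, z) \<in> parcs G \<and> (y, z) \<in> parcs G))"
    by (rule sum.cong) (simp_all add: adjacency_def)
  thus ?thesis
    by (simp only: sum_of_bool_card[OF pair_finite_verts] common_neighbours_def)
qed

section \<open>Switching in terms of the sign vector\<close>

lemma pair_graph_switch:
  assumes "pair_graph G"
  shows "pair_graph (switch G H)"
proof -
  interpret pair_graph G by fact
  have sub: "parcs (switch G H) \<subseteq> pverts G \<times> pverts G"
    by (auto simp: switch_def)
  have fin: "finite (parcs (switch G H))"
    by (rule finite_subset[OF sub]) simp
  have "(x, x) \<notin> parcs (switch G H)" for x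
    using no_loops[of "(x, x)"] by (auto simp: switch_def)
  moreover have "sym (parcs (switch G H))"
    using arcs_symmetric by (auto simp: switch_def sym_def split: if_splits)
  ultimately show ?thesis
    using fin sub
    by unfold_locales (auto simp: switch_def symmetric_def arcs_ends_def arc_to_ends_def)
qed

text \<open>The product of the two signs is 1 on one side of the cut and -1 across it, so the affine
  expression is either a or 1 - a, where a is the old entry. Equivalently, switching conjugates J -
  2A by the diagonal matrix of signs.\<close>

lemma adjacency_switch:
  assumes "x \<in> pverts G" "y \<in> pverts G"
  shows "adjacency (switch G H) x y
           = adjacency G x y * (sign_of H x * sign_of H y) + (1 - sign_of H x * sign_of H y) / 2"
  using assms by (auto simp: adjacency_def switch_def sign_of_def)

lemma sum_adjacency_switch:
  assumes "x \<in> pverts G"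
  shows "(\<Sum>y\<in>pverts G. adjacency (switch G H) x y)
           = sign_of H x * adj_op G (sign_of H) x
             + (real (card (pverts G)) - sign_of H x * (\<Sum>y\<in>pverts G. sign_of H y)) / 2"
proof -
  have "(\<Sum>y\<in>pverts G. adjacency (switch G H) x y)
      = (\<Sum>y\<in>pverts G. sign_of H x * (adjacency G x y * sign_of H y)
           + (1 - sign_of H x * sign_of H y) / 2)"
    using assms by (intro sum.cong) (auto simp: adjacency_switch algebra_simps)
  thus ?thesis
    by (simp add: sum.distrib sum_subtractf adj_op_def flip: sum_distrib_left sum_divide_distrib)
qed

section \<open>The quadratic identity of a strongly regular graph\<close>

locale srg =
  fixes G :: "'a pair_pre_digraph" and v k lam mu :: real
  assumes srg: "strongly_regular G v k lam mu"
begin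

lemma pair_graph: "pair_graph G"
  using srg by (simp add: strongly_regular_def)

sublocale pair_graph G
  by (rule pair_graph)

lemma card_verts: "real (card (pverts G)) = v"
  using srg by (simp add: strongly_regular_def)

lemma adjacency_sym: "adjacency G x y = adjacency G y x"
  using arcs_symmetric by (auto simp: adjacency_def)

lemma sum_adjacency:
  assumes "x \<in> pverts G"
  shows "(\<Sum>y\<in>pverts G. adjacency G x y) = k"
  using srg assms
  by (simp add: strongly_regular_def regular_def out_degree_with_proj[OF pair_graph])

text \<open>This is A^2 = (k - mu) I + (lam - mu) A + mu J, entry by entry; A A^T is A^2 because A
  is symmetric.\<close>

lemma sum_adjacency_product:
  assumes "x \<in> pverts G" "y \<in> pverts G"
  shows "(\<Sum>z\<in>pverts G. adjacency G x z * adjacency G y z)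
           = (k - mu) * of_bool (x = y) + (lam - mu) * adjacency G x y + mu"
proof (cases "x = y")
  case True
  have "(\<Sum>z\<in>pverts G. adjacency G x z * adjacency G x z) = (\<Sum>z\<in>pverts G. adjacency G x z)"
    by (simp add: adjacency_def)
  moreover have "adjacency G x x = 0"
    using no_loops[of "(x, x)"] by (auto simp: adjacency_def)
  ultimately show ?thesis
    using True sum_adjacency[OF assms(1)] by simp
next
  case False
  have "real (card (common_neighbours G x y)) = (if (x, y) \<in> parcs G then lam else mu)"
    using srg assms False by (simp add: strongly_regular_def)
  thus ?thesis
    using False by (simp add: card_common_neighbours[OF pair_graph] adjacency_def)
qed

lemma adj_op_adj_op:
  assumes "x \<in> pverts G"
  shows "adj_op G (adj_op G f) x
           = (k - mu) * f x + (lam - mu) * adj_op G f x + mu * (\<Sum>y\<in>pverts G. f y)"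
proof -
  have "adj_op G (adj_op G f) x
      = (\<Sum>z\<in>pverts G. \<Sum>y\<in>pverts G. adjacency G x z * adjacency G y z * f y)"
    by (simp add: adj_op_def sum_distrib_left mult.assoc adjacency_sym)
  also have "\<dots> = (\<Sum>y\<in>pverts G. \<Sum>z\<in>pverts G. adjacency G x z * adjacency G y z * f y)"
    by (rule sum.swap)
  also have "\<dots> = (\<Sum>y\<in>pverts G.
      ((k - mu) * of_bool (x = y) + (lam - mu) * adjacency G x y + mu) * f y)"
    using assms by (intro sum.cong) (simp_all add: sum_adjacency_product flip: sum_distrib_right)
  also have "\<dots> = (\<Sum>y\<in>pverts G. (k - mu) * (if x = y then f y else 0)
      + (lam - mu) * (adjacency G x y * f y) + mu * f y)"
    by (intro sum.cong) (auto simp: algebra_simps)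
  also have "\<dots> = (k - mu) * f x + (lam - mu) * adj_op G f x + mu * (\<Sum>y\<in>pverts G. f y)"
    using assms by (simp add: sum.distrib adj_op_def flip: sum_distrib_left)
  finally show ?thesis .
qed

lemma adj_op_selfadjoint:
  "(\<Sum>x\<in>pverts G. f x * adj_op G g x) = (\<Sum>x\<in>pverts G. adj_op G f x * g x)"
proof -
  have "(\<Sum>x\<in>pverts G. f x * adj_op G g x)
      = (\<Sum>x\<in>pverts G. \<Sum>y\<in>pverts G. f x * adjacency G x y * g y)"
    by (simp add: adj_op_def sum_distrib_left mult.assoc)
  also have "\<dots> = (\<Sum>y\<in>pverts G. \<Sum>x\<in>pverts G. f x * adjacency G x y * g y)"
    by (rule sum.swap)
  also have "\<dots> = (\<Sum>y\<in>pverts G. adj_op G f y * g y)"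
    unfolding adj_op_def sum_distrib_right
    by (intro sum.cong refl) (metis adjacency_sym mult.commute)
  finally show ?thesis .
qed

text \<open>Self-adjointness moves the operator onto the constant function 1, which it multiplies by
  \<open>k\<close>.\<close>

lemma sum_adj_op: "(\<Sum>x\<in>pverts G. adj_op G f x) = k * (\<Sum>x\<in>pverts G. f x)"
proof -
  have "(\<Sum>x\<in>pverts G. adj_op G f x) = (\<Sum>x\<in>pverts G. adj_op G (\<lambda>_. 1) x * f x)"
    using adj_op_selfadjoint[of "\<lambda>_. 1" f] by simp
  also have "\<dots> = (\<Sum>x\<in>pverts G. k * f x)"
    by (intro sum.cong) (simp_all add: adj_op_def sum_adjacency)
  finally show ?thesis
    by (simp add: sum_distrib_left)
qed

section \<open>Quadratic equations of the eigenvalues\<close>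

lemma eigenvalue_k_quadratic:
  assumes "pverts G \<noteq> {}"
  shows "k * k = (k - mu) + (lam - mu) * k + mu * v"
proof -
  obtain x where x: "x \<in> pverts G"
    using assms by auto
  have "adj_op G (adj_op G (\<lambda>_. 1)) x = adj_op G (\<lambda>_. k * 1) x"
    \<comment> \<open>The inner application is known to be the constant \<open>k\<close> only at
      vertices, so just the outer operator is unfolded and the equality is used under its
      sum.\<close>
    unfolding adj_op_def[of G "adj_op G (\<lambda>_. 1)"] adj_op_def[of G "\<lambda>_. k * 1"]
    by (intro sum.cong) (simp_all add: adj_op_def sum_adjacency)
  also have "\<dots> = k * k"
    using sum_adjacency[OF x] by (simp only: adj_op_scale) (simp add: adj_op_def)
  finally show ?thesis
    using adj_op_adj_op[OF x, of "\<lambda>_. 1"] sum_adjacency[OF x]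
    by (simp add: card_verts) (simp add: adj_op_def)
qed

text \<open>An eigenvector for \<open>t \<noteq> k\<close> is orthogonal to the constants, so the J
  term of the quadratic identity vanishes on it.\<close>

lemma eigenvalue_quadratic:
  assumes "distinct vs" "set vs = pverts G"
    and "eigenvalue (adjacency_matrix vs G) t" "t \<noteq> k"
  shows "t * t = (k - mu) + (lam - mu) * t"
proof -
  define n where "n = length vs"
  have bij: "bij_betw ((!) vs) {0..<n} (pverts G)"
    using bij_betw_nth[OF assms(1) refl, of "pverts G"] assms(2)
    by (simp add: n_def atLeast0LessThan)
  obtain w where w: "w \<in> carrier_vec n" "w \<noteq> 0\<^sub>v n" "adjacency_matrix vs G *\<^sub>v w = t \<cdot>\<^sub>v w"
    using assms(3) unfolding eigenvalue_def eigenvector_def by (auto simp: adjacency_matrix_def n_def)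
  \<comment> \<open>The eigenvector is carried from indices to vertices along the inverse of the
    enumeration.\<close>
  define f where "f x = w $ the_inv_into {0..<n} ((!) vs) x" for x
  have f_nth: "f (vs ! i) = w $ i" if "i < n" for i
    using that bij by (simp add: f_def bij_betw_def the_inv_into_f_f)
  have ev: "adj_op G f x = t * f x" if x: "x \<in> pverts G" for x
  proof -
    obtain i where i: "i < n" "x = vs ! i"
      using x assms(2) by (metis in_set_conv_nth n_def)
    have "adj_op G f x = (\<Sum>j\<in>{0..<n}. adjacency G x (vs ! j) * f (vs ! j))"
      unfolding adj_op_def by (rule sum.reindex_bij_betw[OF bij, symmetric])
    also have "\<dots> = (\<Sum>j\<in>{0..<n}. adjacency G (vs ! i) (vs ! j) * w $ j)"
      using i(2) by (intro sum.cong) (simp_all add: f_nth)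
    also have "\<dots> = (adjacency_matrix vs G *\<^sub>v w) $ i"
      using i(1) w(1)
      by (simp add: adjacency_matrix_def scalar_prod_def adjacency_def of_bool_def flip: n_def)
    also have "\<dots> = t * f x"
      using i w(1,3) by (simp add: f_nth)
    finally show ?thesis .
  qed
  have "(\<Sum>x\<in>pverts G. adj_op G f x) = (\<Sum>x\<in>pverts G. t * f x)"
    by (intro sum.cong) (simp_all add: ev)
  hence "k * (\<Sum>x\<in>pverts G. f x) = t * (\<Sum>x\<in>pverts G. f x)"
    by (simp only: sum_adj_op sum_distrib_left)
  hence sum0: "(\<Sum>x\<in>pverts G. f x) = 0"
    using assms(4) by simp
  \<comment> \<open>A nonzero coordinate, by which the final scalar equation can be divided.\<close>
  obtain i where i: "i < n" "w $ i \<noteq> 0"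
    using w(1,2) by (metis eq_vecI carrier_vecD index_zero_vec)
  let ?x = "vs ! i"
  have x: "?x \<in> pverts G"
    using i assms(2) by (metis nth_mem n_def)
  have "adj_op G (adj_op G f) ?x = adj_op G (\<lambda>y. t * f y) ?x"
    unfolding adj_op_def[of G "adj_op G f"] adj_op_def[of G "\<lambda>y. t * f y"]
    by (intro sum.cong) (simp_all add: ev)
  also have "\<dots> = t * (t * f ?x)"
    by (simp add: adj_op_scale ev[OF x])
  finally have "(t * t) * f ?x = ((k - mu) + (lam - mu) * t) * f ?x"
    using adj_op_adj_op[OF x, of f] by (simp add: sum0 ev[OF x] algebra_simps)
  thus ?thesis
    using i f_nth by simp
qed

section \<open>The sign vector as an eigenvector and its consequences for counting\<close>

lemma adj_op_sign_of_eigenvector: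
  assumes H: "H \<subseteq> pverts G" "2 * real (card H) = v"
    and sum_roots: "t1 + t2 = lam - mu" and prod_roots: "t1 * t2 = mu - k"
    and on_H: "\<And>x. x \<in> H \<Longrightarrow> adj_op G (sign_of H) x = t2"
    and x: "x \<in> pverts G"
  shows "adj_op G (sign_of H) x = t2 * sign_of H x"
proof -
  define s where "s = sign_of H"
  define g where "g y = adj_op G s y - t2 * s y" for y
  have sum_s: "(\<Sum>y\<in>pverts G. s y) = 0"
    using H by (simp add: s_def sum_sign_of card_verts)
  have g_H: "g y = 0" if "y \<in> H" for y
    using that on_H by (simp add: g_def s_def sign_of_def)
  have sum_g: "(\<Sum>y\<in>pverts G. g y) = 0"
    by (simp add: g_def sum_subtractf sum_adj_op sum_s flip: sum_distrib_left)
  \<comment> \<open>On \<open>H\<close> the function \<open>g\<close> vanishes, and off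
    \<open>H\<close> the sign is -1, so \<open>g y * s y\<close> equals \<open>- g y\<close> at
    every vertex.\<close>
  have "(\<Sum>y\<in>pverts G. g y * s y) = (\<Sum>y\<in>pverts G. - g y)"
    using g_H by (intro sum.cong) (auto simp: s_def sign_of_def)
  hence sum_gs: "(\<Sum>y\<in>pverts G. g y * s y) = 0"
    using sum_g by (simp add: sum_negf)
  have Ag: "adj_op G g y = t1 * g y" if y: "y \<in> pverts G" for y
  proof -
    have "adj_op G g y = adj_op G (adj_op G s) y - t2 * adj_op G s y"
      unfolding g_def by (simp add: adj_op_diff adj_op_scale)
    \<comment> \<open>The J term drops out because \<open>s\<close> sums to zero; the rest of the
      quadratic factors, giving (A - t1)(A - t2) s = 0.\<close>
    also have "\<dots> = - (t1 * t2) * s y + (t1 + t2) * adj_op G s y - t2 * adj_op G s y"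
      using adj_op_adj_op[OF y, of s] by (simp add: sum_s sum_roots prod_roots)
    finally show ?thesis
      by (simp add: g_def algebra_simps)
  qed
  have "(\<Sum>y\<in>pverts G. g y * g y) = (\<Sum>y\<in>pverts G. g y * adj_op G s y - t2 * (g y * s y))"
    by (simp add: g_def algebra_simps)
  also have "\<dots> = (\<Sum>y\<in>pverts G. adj_op G g y * s y) - t2 * (\<Sum>y\<in>pverts G. g y * s y)"
    by (simp add: sum_subtractf adj_op_selfadjoint flip: sum_distrib_left)
  also have "(\<Sum>y\<in>pverts G. adj_op G g y * s y) = t1 * (\<Sum>y\<in>pverts G. g y * s y)"
    by (simp add: Ag sum_distrib_left mult.assoc)
  finally have "(\<Sum>y\<in>pverts G. g y * g y) = 0"
    by (simp add: sum_gs)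
  hence "g x = 0"
    using x by (subst (asm) sum_nonneg_eq_0_iff) auto
  thus ?thesis
    by (simp add: g_def s_def)
qed

text \<open>Expanding the product of two switched entries with squared signs equal to 1 leaves the
  old product, entries of A, entries of A times a sign, and signs. Their sums are the old count,
  \<open>k\<close>, the eigenvalue equation and zero.\<close>

lemma card_common_neighbours_switch:
  assumes H: "H \<subseteq> pverts G" "2 * real (card H) = v"
    and eig: "\<And>x. x \<in> pverts G \<Longrightarrow> adj_op G (sign_of H) x = t * sign_of H x"
    and xy: "x \<in> pverts G" "y \<in> pverts G"
  shows "real (card (common_neighbours (switch G H) x y))
           = sign_of H x * sign_of H y * (real (card (common_neighbours G x y)) - k + v / 4)
             + t + v / 4"
proof -
  define s where "s = sign_of H"
  have sq: "s z * s z = 1" for z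
    by (simp add: s_def)
  have sum_s: "(\<Sum>z\<in>pverts G. s z) = 0"
    using H by (simp add: s_def sum_sign_of card_verts)
  let ?a = "adjacency G"
  have "real (card (common_neighbours (switch G H) x y))
      = (\<Sum>z\<in>pverts G. adjacency (switch G H) x z * adjacency (switch G H) y z)"
    by (subst card_common_neighbours[OF pair_graph_switch[OF pair_graph]]) (simp add: switch_def)
  also have "\<dots> = (\<Sum>z\<in>pverts G. s x * s y * (?a x z * ?a y z)
      + s x / 2 * (?a x z * s z) - s x * s y / 2 * ?a x z
      + s y / 2 * (?a y z * s z) - s x * s y / 2 * ?a y z
      + (1 + s x * s y) / 4 - (s x + s y) / 4 * s z)"
  proof (rule sum.cong)
    fix z assume "z \<in> pverts G"
    hence "adjacency (switch G H) x z * adjacency (switch G H) y z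
        = (?a x z * (s x * s z) + (1 - s x * s z) / 2) * (?a y z * (s y * s z) + (1 - s y * s z) / 2)"
      using xy by (simp add: adjacency_switch s_def)
    also have "\<dots> = s x * s y * (?a x z * ?a y z)
      + s x / 2 * (?a x z * s z) - s x * s y / 2 * ?a x z
      + s y / 2 * (?a y z * s z) - s x * s y / 2 * ?a y z
      + (1 + s x * s y) / 4 - (s x + s y) / 4 * s z"
      by (auto simp: s_def sign_of_def algebra_simps)
    finally show "adjacency (switch G H) x z * adjacency (switch G H) y z = \<dots>" .
  qed simp
  also have "\<dots> = s x * s y * (\<Sum>z\<in>pverts G. ?a x z * ?a y z)
      + s x / 2 * adj_op G s x - s x * s y / 2 * k
      + s y / 2 * adj_op G s y - s x * s y / 2 * k
      + v * ((1 + s x * s y) / 4)"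
    using xy by (simp only: sum.distrib sum_subtractf sum_distrib_left[symmetric] adj_op_def
        sum_adjacency sum_s sum_constant card_verts)
  also have "\<dots> = s x * s y * (\<Sum>z\<in>pverts G. ?a x z * ?a y z)
      + t / 2 * (s x * s x) + t / 2 * (s y * s y) - s x * s y * k + v * ((1 + s x * s y) / 4)"
    using eig xy by (simp add: s_def mult.left_commute)
  finally show ?thesis
    unfolding sq by (simp add: card_common_neighbours[OF pair_graph] s_def algebra_simps)
qed

end

section \<open>Relations between the eigenvalues and the parameters, and the equivalence for the
  switched graph\<close>

theorem theorem1p2:
  fixes G :: "'a pair_pre_digraph" and H :: "'a set" and vs :: "'a list"
    and v k lam mu :: nat and \<theta>\<^sub>1 \<theta>\<^sub>2 c :: real
  assumes "strongly_regular G (real v) (real k) (real lam) (real mu)"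
    and "primitive G"
    and "distinct vs" and "set vs = pverts G"
    and "{t. eigenvalue (adjacency_matrix vs G) t} = {real k, \<theta>\<^sub>1, \<theta>\<^sub>2}"
    and "real k > \<theta>\<^sub>1" and "\<theta>\<^sub>1 > \<theta>\<^sub>2"
    and "H \<subseteq> pverts G"
    and "real v = 2 * (real k - \<theta>\<^sub>1)"
    and "c = real v / 2 - 2 * real mu"
  shows "strongly_regular (switch G H) (real v) (real k + c) (real lam + c) (real mu + c)
     \<longleftrightarrow>
     real (card H) = real v / 2 \<and> regular (with_proj G \<restriction> H) (real k - real mu)"
proof -
  interpret srg G "real v" "real k" "real lam" "real mu"
    by unfold_locales (fact assms(1))
  define s where "s = sign_of H"
  have ev: "eigenvalue (adjacency_matrix vs G) \<theta>\<^sub>1" "eigenvalue (adjacency_matrix vs G) \<theta>\<^sub>2"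
    using assms(5) by blast+
  have q1: "\<theta>\<^sub>1 * \<theta>\<^sub>1 = (real k - real mu) + (real lam - real mu) * \<theta>\<^sub>1"
    using assms(6) by (intro eigenvalue_quadratic[OF assms(3,4) ev(1)]) simp
  have q2: "\<theta>\<^sub>2 * \<theta>\<^sub>2 = (real k - real mu) + (real lam - real mu) * \<theta>\<^sub>2"
    using assms(6,7) by (intro eigenvalue_quadratic[OF assms(3,4) ev(2)]) simp
  have "(\<theta>\<^sub>1 - \<theta>\<^sub>2) * (\<theta>\<^sub>1 + \<theta>\<^sub>2) = (\<theta>\<^sub>1 - \<theta>\<^sub>2) * (real lam - real mu)"
    using q1 q2 by (simp add: algebra_simps)
  hence sum_roots: "\<theta>\<^sub>1 + \<theta>\<^sub>2 = real lam - real mu"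
    using assms(7) by simp
  have prod_roots: "\<theta>\<^sub>1 * \<theta>\<^sub>2 = real mu - real k"
    using q1 unfolding sum_roots[symmetric] by (simp add: algebra_simps)
  have "pverts G \<noteq> {}"
    using card_verts assms(6,9) by auto
  from eigenvalue_k_quadratic[OF this]
  have "real mu * real v = real k * real k - (\<theta>\<^sub>1 + \<theta>\<^sub>2) * real k + \<theta>\<^sub>1 * \<theta>\<^sub>2"
    unfolding sum_roots prod_roots by simp
  \<comment> \<open>The right-hand side above factors as (k - \<theta>1)(k - \<theta>2), and v = 2(k
    - \<theta>1) exposes the same nonzero factor on the left.\<close>
  hence "(real k - \<theta>\<^sub>1) * (2 * real mu) = (real k - \<theta>\<^sub>1) * (real k - \<theta>\<^sub>2)"
    using assms(9) by (simp add: algebra_simps)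
  hence \<theta>2: "\<theta>\<^sub>2 = real k - 2 * real mu"
    using assms(6) by simp
  have c: "c = \<theta>\<^sub>2 - \<theta>\<^sub>1"
    using assms(9,10) \<theta>2 by simp
  have sum_s: "(\<Sum>x\<in>pverts G. s x) = 2 * real (card H) - real v"
    using assms(8) by (simp add: s_def sum_sign_of card_verts)
  \<comment> \<open>Twice the inner valency is k plus the value of A s, and k + \<theta>2 = 2(k -
    mu).\<close>
  have induced: "regular (with_proj G \<restriction> H) (real k - real mu) \<longleftrightarrow> (\<forall>x\<in>H. adj_op G s x = \<theta>\<^sub>2)"
  proof -
    have "real (out_degree (with_proj G \<restriction> H) x) = real k - real mu \<longleftrightarrow> adj_op G s x = \<theta>\<^sub>2"
      if x: "x \<in> H" for x
    proof -
      have "x \<in> pverts G"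
        using x assms(8) by auto
      thus ?thesis
        using out_degree_induced[OF pair_graph assms(8) x] sum_adjacency[of x] \<theta>2
        by (auto simp: s_def)
    qed
    thus ?thesis
      by (simp add: regular_def)
  qed
  have degree_switch: "real (out_degree (with_proj (switch G H)) x)
      = s x * adj_op G s x + (real v - s x * (2 * real (card H) - real v)) / 2"
    if "x \<in> pverts G" for x
    unfolding out_degree_with_proj[OF pair_graph_switch[OF pair_graph]]
    using sum_adjacency_switch[OF that, of H] sum_s by (simp add: s_def card_verts switch_def)
  show ?thesis
  proof
    assume "strongly_regular (switch G H) (real v) (real k + c) (real lam + c) (real mu + c)"
    hence deg: "s x * adj_op G s x
        = real k + c - (real v - s x * (2 * real (card H) - real v)) / 2"
      if "x \<in> pverts G" for x
      using degree_switch[OF that] that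
      by (simp add: strongly_regular_def regular_def switch_def)
    \<comment> \<open>Multiplying \<open>deg\<close> by \<open>s x\<close> isolates A s, since the
      sign squares to 1.\<close>
    have As: "adj_op G s x = (real k + c - real v / 2) * s x + (2 * real (card H) - real v) / 2"
      if "x \<in> pverts G" for x
      using deg[OF that] by (auto simp: s_def sign_of_def field_simps)
    have "(\<Sum>x\<in>pverts G. adj_op G s x)
        = (real k + c - real v / 2) * (\<Sum>x\<in>pverts G. s x) + real v * ((2 * real (card H) - real v) / 2)"
      by (simp add: As sum.distrib card_verts flip: sum_distrib_left)
    \<comment> \<open>With d = 2|H| - v the two sides are k d and (k + c - v/2) d + (v/2) d.\<close>
    hence "c * (2 * real (card H) - real v) = 0"
      unfolding sum_adj_op sum_s by argo
    hence h: "2 * real (card H) = real v"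
      using c assms(7) by simp
    \<comment> \<open>The coefficient of \<open>s x\<close> in \<open>As\<close> is k + c - v/2 = k
      - 2 mu, which is \<theta>2, and the constant term is now zero.\<close>
    moreover have "adj_op G s x = \<theta>\<^sub>2" if "x \<in> H" for x
      using As[of x] that assms(8) h \<theta>2 assms(10) by (auto simp: s_def sign_of_def)
    ultimately show "real (card H) = real v / 2 \<and> regular (with_proj G \<restriction> H) (real k - real mu)"
      using induced by simp
  next
    assume *: "real (card H) = real v / 2 \<and> regular (with_proj G \<restriction> H) (real k - real mu)"
    hence h: "2 * real (card H) = real v" and on_H: "\<And>x. x \<in> H \<Longrightarrow> adj_op G s x = \<theta>\<^sub>2"
      using induced by auto
    have eig: "adj_op G (sign_of H) x = \<theta>\<^sub>2 * sign_of H x" if "x \<in> pverts G" for x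
      using adj_op_sign_of_eigenvector[OF assms(8) h sum_roots prod_roots _ that] on_H
      by (simp add: s_def)
    have deg: "real (out_degree (with_proj (switch G H)) x) = real k + c" if "x \<in> pverts G" for x
      using degree_switch[OF that] eig[OF that] h \<theta>2 assms(10)
      by (auto simp: s_def sign_of_def)
    have common: "real (card (common_neighbours (switch G H) x y))
        = (if (x, y) \<in> parcs (switch G H) then real lam + c else real mu + c)"
      if xy: "x \<in> pverts G" "y \<in> pverts G" "x \<noteq> y" for x y
    proof -
      have "real (card (common_neighbours G x y))
          = (if (x, y) \<in> parcs G then real lam else real mu)"
        using assms(1) xy by (simp add: strongly_regular_def)
      \<comment> \<open>This is what makes pairs separated by \<open>H\<close> work: there adjacency
        flips, so the old count \<open>lam\<close> must become mu + c and the old count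
        \<open>mu\<close> must become lam + c.\<close>
      moreover have "2 * real k - real mu - real lam = real v / 2"
        using assms(9) sum_roots \<theta>2 by simp
      ultimately show ?thesis
        using card_common_neighbours_switch[OF assms(8) h eig xy(1,2)] xy \<theta>2 assms(10)
        by (auto simp: sign_of_def switch_def)
    qed
    \<comment> \<open>The clause for adjacent pairs does not exclude equal vertices, whereas
      \<open>common\<close> requires distinct ones.\<close>
    have "x \<noteq> y" if "(x, y) \<in> parcs (switch G H)" for x y
      using that no_loops[of "(x, x)"] by (auto simp: switch_def)
    thus "strongly_regular (switch G H) (real v) (real k + c) (real lam + c) (real mu + c)"
      unfolding strongly_regular_def regular_def
      using pair_graph_switch[OF pair_graph] card_verts deg common by (auto simp: switch_def)
  qed
qed

end
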